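(* There is an absolute constant $C>0$ such that for every string $w$ of length $n\ge 2$, $r_B(w)\le C\, z(w)\log^2 n$. Here $r_B(w)$ is the number of maximal runs of equal characters in $\mathsf{BBWT}(w)$, and $z(w)$ is the number of phrases in the Lempel–Ziv 77 parsing of $w$.
   Context: Strings are over a totally ordered alphabet, with lexicographic order $\prec$. A Lyndon word is a nonempty string strictly lexicographically smaller than all of its proper nonempty suffixes. Every string $w$ has a unique Lyndon factorization $w=u_1\cdots u_m$ into Lyndon words with $u_1\succeq\cdots\succeq u_m$. For primitive strings $x,y$, $x\prec_\omega y$ iff $x^\infty\prec y^\infty$, where $x^\infty = xxx\cdots$. $\mathsf{BBWT}(w)$ is obtained as follows: take the multiset of all cyclic rotations of all factors $u_j$ (each $u_j$ contributing its $|u_j|$ rotations, repeated factors contributing repeatedly), sort it in $\omega$-order, and concatenate the last characters. The LZ77 parsing of $w$ factorizes $w$ greedily from left to right. Each phrase starting at position $p$ is either the single character $w[p]$, if $w[p]$ does not occur before $p$, or else the longest prefix of $w[p..n]$ that also occurs starting at some position $q<p$ (occurrences may overlap). $z(w)$ is the number of phrases. *)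

theory Defs
  imports Complex_Main "HOL-Library.List_Lexorder" "HOL-Library.Multiset" "HOL-Library.Stream"
begin

(* The order < on strings is the lexicographic one of List_Lexorder:
   a proper prefix is smaller than the whole string. *)

definition lyndon :: "'a::linorder list \<Rightarrow> bool" where
  "lyndon w \<longleftrightarrow> w \<noteq> [] \<and> (\<forall>u v. w = u @ v \<and> u \<noteq> [] \<and> v \<noteq> [] \<longrightarrow> w < v)"

definition is_lyndon_factorization :: "'a::linorder list \<Rightarrow> 'a list list \<Rightarrow> bool" where
  "is_lyndon_factorization w us \<longleftrightarrow>
     concat us = w \<and> (\<forall>u\<in>set us. lyndon u) \<and> sorted_wrt (\<ge>) us"

(* Well defined by the Chen-Fox-Lyndon theorem. *)
definition lyndon_factors :: "'a::linorder list \<Rightarrow> 'a list list" where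
  "lyndon_factors w = (THE us. is_lyndon_factorization w us)"

(* cycle x is the infinite repetition of x, for nonempty x. *)
definition omega_less :: "'a::linorder list \<Rightarrow> 'a list \<Rightarrow> bool" where
  "omega_less x y \<longleftrightarrow>
     (\<exists>k. (\<forall>i<k. cycle x !! i = cycle y !! i) \<and> cycle x !! k < cycle y !! k)"

(* One entry for each of the length u rotation amounts. *)
definition rotations :: "'a list \<Rightarrow> 'a list list" where
  "rotations u = map (\<lambda>i. rotate i u) [0..<length u]"

definition bbwt_rotations :: "'a::linorder list \<Rightarrow> 'a list multiset" where
  "bbwt_rotations w = mset (concat (map rotations (lyndon_factors w)))"

(* Rotations of Lyndon words are primitive, and primitive words with the same
   infinite repetition are equal, so the sorted list is unique. *)
definition bbwt_matrix :: "'a::linorder list \<Rightarrow> 'a list list" where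
  "bbwt_matrix w =
     (THE xs. mset xs = bbwt_rotations w \<and> sorted_wrt (\<lambda>x y. \<not> omega_less y x) xs)"

definition bbwt :: "'a::linorder list \<Rightarrow> 'a list" where
  "bbwt w = map last (bbwt_matrix w)"

(* remdups_adj collapses each maximal run of equal characters to a single character. *)
definition runs :: "'a list \<Rightarrow> nat" where
  "runs s = length (remdups_adj s)"

definition r_B :: "'a::linorder list \<Rightarrow> nat" where
  "r_B w = runs (bbwt w)"

(* Positions are 0-based. The earlier occurrence, starting at q < p, may overlap the phrase. *)
definition lz_len :: "'a list \<Rightarrow> nat \<Rightarrow> nat" where
  "lz_len w p =
     (if w ! p \<notin> set (take p w) then 1
      else Max {l. p + l \<le> length w \<and> (\<exists>q<p. take l (drop q w) = take l (drop p w))})"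

lemma lz_len_pos:
  assumes "p < length w"
  shows "lz_len w p \<ge> 1"
proof (cases "w ! p \<in> set (take p w)")
  case True
  let ?S = "{l. p + l \<le> length w \<and> (\<exists>q<p. take l (drop q w) = take l (drop p w))}"
  from True assms obtain q where q: "q < p" "w ! q = w ! p"
    by (auto simp: in_set_conv_nth)
  then have "take 1 (drop q w) = take 1 (drop p w)"
    using assms by (simp add: Cons_nth_drop_Suc [symmetric])
  with q(1) assms have "1 \<in> ?S" by auto
  moreover have "finite ?S"
    by (rule finite_subset [of _ "{..length w}"]) auto
  ultimately have "1 \<le> Max ?S" by (intro Max_ge)
  with True show ?thesis by (simp add: lz_len_def)
qed (simp add: lz_len_def)

function lz_parse_from :: "'a list \<Rightarrow> nat \<Rightarrow> 'a list list" where
  "lz_parse_from w p =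
     (if p < length w
      then take (lz_len w p) (drop p w) # lz_parse_from w (p + lz_len w p)
      else [])"
  by pat_completeness auto
termination
proof (relation "measure (\<lambda>(w, p). length w - p)")
  fix w :: "'a list" and p :: nat
  assume "p < length w"
  then show "((w, p + lz_len w p), (w, p)) \<in> measure (\<lambda>(w, p). length w - p)"
    using lz_len_pos [of p w] by auto
qed simp

declare lz_parse_from.simps [simp del]

definition lz77_parse :: "'a list \<Rightarrow> 'a list list" where
  "lz77_parse w = lz_parse_from w 0"

definition z_LZ :: "'a list \<Rightarrow> nat" where
  "z_LZ w = length (lz77_parse w)"

end

theory Submission
  imports Defs
begin

text \<open>
  The argument follows Kempa and Kociumaka's bound on the number of runs of the BWT.  Suppose two
  neighbours in the sorted rotations are preceded by different letters and their longest common
  prefix has length in \<open>[l, 2l)\<close>.  For each of \<open>l\<close> alignments, the rarer of the two left contexts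
  halves the number of occurrences and is charged to a cyclic window of length \<open>3l\<close>; a window is
  charged \<open>O(log n)\<close> times.  There are \<open>O(log n)\<close> scales \<open>l = 2\<^sup>t\<close>.

  It remains to see that the Lyndon factors have \<open>O(z L)\<close> distinct cyclic windows of length \<open>L\<close>.
  The leftmost occurrence of a substring contains the last position of an LZ77 phrase.  A cyclic
  window of a factor \<open>u\<close> either continues into the word after the last copy of \<open>u\<close>, hence is a substring of
  \<open>w\<close>, or this copy is followed by a text that is strictly smaller than \<open>u\<close> within \<open>min L \<bar>u\<bar>\<close>
  letters.  All earlier suffixes being at least \<open>u\<close>, this text is then a new length-\<open>L\<close> substring
  and so is close to a phrase end.
\<close>

section \<open>Lyndon factorizations\<close>

lemma take_mono_lex: "xs \<le> ys \<Longrightarrow> take c xs \<le> take c (ys :: 'a::linorder list)"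
proof (induction c arbitrary: xs ys)
  case (Suc c)
  then show ?case by (cases xs; cases ys) (auto simp: less_imp_le)
qed simp

lemma le_append_lex: "xs \<le> xs @ (ys :: 'a::linorder list)"
  by (induction xs) auto

lemma take_le_lex: "take c xs \<le> (xs :: 'a::linorder list)"
  by (metis append_take_drop_id le_append_lex)

lemma append_less_cancel_lex: "xs @ ys < xs @ zs \<longleftrightarrow> ys < (zs :: 'a::linorder list)"
  by (induction xs) auto

lemma append_le_cancel_lex: "xs @ ys \<le> xs @ zs \<longleftrightarrow> ys \<le> (zs :: 'a::linorder list)"
  by (induction xs) auto

text \<open>As \<open>ys\<close> is no longer than \<open>xs\<close>, \<open>xs\<close> cannot be a
  proper prefix of \<open>ys\<close>; the comparison is decided at a mismatch and survives arbitrary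
  extensions.\<close>

lemma less_append_lex:
  "xs < ys \<Longrightarrow> length ys \<le> length xs \<Longrightarrow> xs @ as < ys @ (bs :: 'a::linorder list)"
proof (induction xs arbitrary: ys)
  case (Cons x xs)
  then show ?case by (cases ys) auto
qed auto

section \<open>Lyndon words and their suffixes\<close>

lemma lyndon_nonempty: "lyndon u \<Longrightarrow> u \<noteq> []"
  by (simp add: lyndon_def)

lemma lyndon_less_suffix:
  "lyndon (u @ v) \<Longrightarrow> u \<noteq> [] \<Longrightarrow> v \<noteq> [] \<Longrightarrow> u @ v < v"
  unfolding lyndon_def by blast

lemma lyndon_less_drop:
  assumes "lyndon u" "0 < k" "k < length u"
  shows "u < drop k u"
  using lyndon_less_suffix[of "take k u" "drop k u"] assms by (cases u) auto

lemma lyndon_le_drop: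
  assumes "lyndon u" "k < length u"
  shows "u \<le> drop k u"
  using lyndon_less_drop[of u k] assms by (cases "k = 0") auto

text \<open>The core is \<open>u @ v < v\<close>: if \<open>u\<close> is a prefix of
  \<open>v\<close>, cancel it and use that \<open>v\<close> is below its own proper suffixes;
  otherwise a mismatch within \<open>u\<close> decides. A suffix inside \<open>v\<close> is at least
  \<open>v\<close>, and one starting inside \<open>u\<close> begins with a proper suffix of
  \<open>u\<close>, which exceeds \<open>u\<close> at a mismatch.\<close>

lemma lyndon_append:
  assumes "lyndon u" "lyndon v" "u < v"
  shows "lyndon (u @ v)"
  unfolding lyndon_def
proof (intro conjI allI impI)
  show "u @ v \<noteq> []" using lyndon_nonempty[OF assms(1)] by simp
  have uv: "u @ v < v"
  proof (cases "take (length u) v = u")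
    case True
    then obtain v' where v': "v = u @ v'" by (metis append_take_drop_id)
    with assms(3) have "v' \<noteq> []" by auto
    then have "v < v'" using lyndon_less_suffix[of u v'] v' assms lyndon_nonempty by auto
    then show ?thesis using v' append_less_cancel_lex by metis
  next
    case False
    have "u \<le> take (length u) v" using take_mono_lex[of u v "length u"] assms(3) by simp
    with False have "u < take (length u) v" by simp
    from less_append_lex[OF this, of v "drop (length u) v"] show ?thesis by simp
  qed
  fix a b assume ab: "u @ v = a @ b \<and> a \<noteq> [] \<and> b \<noteq> []"
  then consider c where "a = u @ c" "v = c @ b" | c where "u = a @ c" "b = c @ v" "c \<noteq> []"
    by (metis append_eq_append_conv2 append.right_neutral append_Nil)
  then show "u @ v < b"
  proof cases
    case 1
    have "v \<le> b" using lyndon_less_suffix[of c b] 1 ab assms(2) by (cases "c = []") auto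
    with uv show ?thesis by simp
  next
    case 2
    then have "u < c" using lyndon_less_suffix[of a c] ab assms(1) by auto
    from less_append_lex[OF this, of v v] 2 show ?thesis by simp
  qed
qed

text \<open>If the first factor \<open>f\<close> is a proper prefix of \<open>u = f @ y\<close>, the
  remaining factors are compared inductively with \<open>u\<close>, and \<open>u \<le> y\<close>
  because \<open>u\<close> is Lyndon. Otherwise \<open>f\<close> already decides the
  comparison.\<close>

lemma take_concat_le_lyndon:
  assumes "lyndon u" "\<forall>f\<in>set fs. f \<le> u" "c \<le> length u"
  shows "take c (concat fs) \<le> take c u"
  using assms(2,3)
proof (induction fs arbitrary: c)
  case (Cons f fs)
  show ?case
  proof (cases "c \<le> length f")
    case True
    then show ?thesis using Cons.prems take_mono_lex[of f u c] by simp
  next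
    case c: False
    with Cons.prems have len: "length f < length u" by simp
    show ?thesis
    proof (cases "take (length f) u = f")
      case True
      define y where "y = drop (length f) u"
      have u: "u = f @ y" using True y_def by (metis append_take_drop_id)
      have "take (c - length f) (concat fs) \<le> take (c - length f) u"
        using Cons by simp
      also have "\<dots> \<le> take (c - length f) y"
        using take_mono_lex[OF lyndon_le_drop[OF assms(1) len]] y_def by simp
      finally have "f @ take (c - length f) (concat fs) \<le> f @ take (c - length f) y"
        by (simp add: append_le_cancel_lex)
      then show ?thesis using u c by simp
    next
      case False
      have "f \<le> take (length f) u" using take_mono_lex[of f u "length f"] Cons.prems by simp
      with False have "f < take (length f) u" by simp
      from less_append_lex[OF this, of "concat fs" "drop (length f) u"] len
      have "f @ concat fs < u" by simp
      then show ?thesis using take_mono_lex[of "f @ concat fs" u c] by simp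
    qed
  qed
qed simp

text \<open>If \<open>u\<close> were a prefix, removing the first factor would leave a proper suffix
  \<open>y\<close> of \<open>u\<close> as a prefix of the other factors. By the previous bound
  \<open>y\<close> would be at most a prefix of \<open>u\<close>, contradicting
  \<open>u < y\<close>.\<close>

lemma lyndon_not_prefix_concat:
  assumes "lyndon u" "\<forall>f\<in>set fs. f < u"
  shows "take (length u) (concat fs) \<noteq> u"
  using assms(2)
proof (induction fs)
  case Nil
  then show ?case using lyndon_nonempty[OF assms(1)] by simp
next
  case (Cons f fs)
  show ?case
  proof
    assume eq: "take (length u) (concat (f # fs)) = u"
    show False
    proof (cases "length u \<le> length f")
      case True
      with eq have "u \<le> f" using take_le_lex[of "length u" f] by simp
      with Cons.prems show False by auto
    next
      case False
      define y where "y = drop (length f) u"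
      have y: "y = take (length y) (concat fs)" "length y = length u - length f"
        using eq False y_def by (metis drop_append drop_take append_eq_append_conv2 concat.simps(2) append_Nil diff_self_eq_0 drop0 drop_all order_refl length_drop) (simp add: y_def)
      have f: "f \<noteq> []" using eq Cons by auto
      have "u < y" using lyndon_less_drop[OF assms(1), of "length f"] False f y_def by simp
      moreover have "y \<le> take (length y) u"
        using take_concat_le_lyndon[OF assms(1), of fs "length y"] Cons.prems y
        by (metis diff_le_self less_imp_le list.set_intros(2))
      moreover have "take (length y) u \<le> u" by (rule take_le_lex)
      ultimately show False by simp
    qed
  qed
qed

section \<open>Uniqueness and existence of the Lyndon factorization\<close>

lemma lyndon_factorization_unique:
  assumes "is_lyndon_factorization w us" "is_lyndon_factorization w vs"
  shows "us = vs"
  using assms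
proof (induction us arbitrary: w vs)
  case Nil
  then show ?case by (cases vs) (auto simp: is_lyndon_factorization_def lyndon_def)
next
  case (Cons u us)
  obtain v vs' where vs: "vs = v # vs'"
    using Cons.prems lyndon_nonempty by (cases vs) (auto simp: is_lyndon_factorization_def)
  \<comment> \<open>If \<open>y\<close> were longer than \<open>x\<close>, then \<open>x\<close>
    would be a proper prefix of \<open>y\<close>, so all factors in \<open>x # xs\<close> would be
    strictly below \<open>y\<close>, although \<open>y\<close> is a prefix of their
    concatenation.\<close>
  have *: "length y \<le> length x"
    if "is_lyndon_factorization w (x # xs)" "is_lyndon_factorization w (y # ys)"
    for x y :: "'a list" and xs ys
  proof (rule ccontr)
    assume len: "\<not> length y \<le> length x"
    have c: "concat (x # xs) = w" "concat (y # ys) = w" "lyndon y" "\<forall>z\<in>set xs. z \<le> x"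
      using that by (auto simp: is_lyndon_factorization_def)
    have ty: "take (length y) (concat (x # xs)) = y"
      unfolding c(1) c(2)[symmetric] by simp
    then have "x = take (length x) y" using len
      by (metis append_eq_append_conv_if concat.simps(2) c(1,2) nat_le_linear append_eq_conv_conj)
    then have "x < y" using len take_le_lex[of "length x" y]
      by (metis nle_le order_le_imp_less_or_eq)
    with c have "\<forall>f\<in>set (x # xs). f < y" by auto
    with lyndon_not_prefix_concat[OF c(3)] ty show False by blast
  qed
  have "length u = length v" using *[of u us v vs'] *[of v vs' u us] Cons.prems vs by auto
  then have uv: "u = v" "concat us = concat vs'" using Cons.prems vs
    by (auto simp: is_lyndon_factorization_def)
  have "is_lyndon_factorization (concat us) us" "is_lyndon_factorization (concat us) vs'"
    using Cons.prems vs uv by (auto simp: is_lyndon_factorization_def)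
  with Cons.IH uv vs show ?case by blast
qed

lemma lyndon_singleton: "lyndon [a]"
  by (auto simp: lyndon_def dest!: sym[of "[a]"] simp: append_eq_Cons_conv)

text \<open>A shortest factorization into Lyndon words is sorted, since two adjacent factors
  in increasing order could be merged.\<close>

lemma lyndon_factorization_exists:
  fixes w :: "'a::linorder list"
  shows "\<exists>us. is_lyndon_factorization w us"
proof -
  define P where "P us \<longleftrightarrow> concat us = w \<and> (\<forall>u\<in>set us. lyndon u)" for us
  have "P (map (\<lambda>a. [a]) w)" by (auto simp: P_def lyndon_singleton)
  then obtain us where us: "P us" and min: "\<And>vs. P vs \<Longrightarrow> length us \<le> length vs"
    using exists_least_iff[of "\<lambda>k. \<exists>us. P us \<and> length us = k"] by (metis not_le)
  have "us ! i \<ge> us ! Suc i" if "Suc i < length us" for i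
  proof (rule ccontr)
    assume "\<not> us ! i \<ge> us ! Suc i"
    moreover have split: "us = take i us @ us ! i # us ! Suc i # drop (Suc (Suc i)) us"
      using that by (metis Cons_nth_drop_Suc Suc_lessD append_take_drop_id)
    moreover have "lyndon (us ! i)" "lyndon (us ! Suc i)"
      using us that by (auto simp: P_def)
    ultimately have "lyndon (us ! i @ us ! Suc i)" by (auto intro: lyndon_append)
    moreover have "set (take i us) \<subseteq> set us" "set (drop (Suc (Suc i)) us) \<subseteq> set us"
      by (auto dest: in_set_takeD in_set_dropD)
    moreover have "concat (take i us @ (us ! i @ us ! Suc i) # drop (Suc (Suc i)) us) = w"
      using us arg_cong[OF split, of concat] by (simp add: P_def)
    ultimately have "P (take i us @ (us ! i @ us ! Suc i) # drop (Suc (Suc i)) us)"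
      using us by (auto simp: P_def)
    from min[OF this] that show False by simp
  qed
  then have "sorted_wrt (\<ge>) us"
    by (subst sorted_wrt_iff_nth_Suc_transp) (auto simp: transp_def)
  with us show ?thesis by (auto simp: is_lyndon_factorization_def P_def)
qed

lemma is_lyndon_factorization_lyndon_factors:
  "is_lyndon_factorization w (lyndon_factors w)"
  unfolding lyndon_factors_def
  by (rule theI') (use lyndon_factorization_exists lyndon_factorization_unique in blast)

lemma set_lyndon_factors: "(\<Union>u\<in>set (lyndon_factors w). set u) = set w"
proof -
  have "concat (lyndon_factors w) = w"
    using is_lyndon_factorization_lyndon_factors[of w] by (simp add: is_lyndon_factorization_def)
  from arg_cong[OF this, of set] show ?thesis by simp
qed

section \<open>Cyclic windows and LZ77 phrases\<close>

text \<open>Leftmost occurrences. Windows running over the end of \<open>w\<close> are truncated;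
  they have pairwise different lengths, so their positions count as new.\<close>

definition new_at :: "'a list \<Rightarrow> nat \<Rightarrow> nat \<Rightarrow> bool" where
  "new_at w L p \<longleftrightarrow> p < length w \<and> (\<forall>q<p. take L (drop q w) \<noteq> take L (drop p w))"

lemma lz_len_cases:
  assumes "p < length w"
  shows "p + lz_len w p \<le> length w"
    and "lz_len w p = 1 \<or> (\<exists>q<p. take (lz_len w p) (drop q w) = take (lz_len w p) (drop p w))"
proof -
  define S where "S = {l. p + l \<le> length w \<and> (\<exists>q<p. take l (drop q w) = take l (drop p w))}"
  have "lz_len w p \<in> S" if p: "w ! p \<in> set (take p w)"
  proof -
    have "0 < p" using p by (cases p) auto
    then have "0 \<in> S" using assms by (auto simp: S_def)
    moreover have "finite S" by (rule finite_subset [of _ "{..length w}"]) (auto simp: S_def)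
    ultimately have "Max S \<in> S" using Max_in by blast
    moreover have "lz_len w p = Max S" using p unfolding lz_len_def S_def by (rule if_not_P[OF not_not[THEN iffD2]])
    ultimately show ?thesis by simp
  qed
  moreover have "lz_len w p = 1" if "w ! p \<notin> set (take p w)"
    unfolding lz_len_def using that by (rule if_P)
  moreover have "p + l \<le> length w" "\<exists>q<p. take l (drop q w) = take l (drop p w)" if "l \<in> S" for l
    using that unfolding S_def by blast+
  moreover have "p + 1 \<le> length w" using assms by simp
  ultimately show "p + lz_len w p \<le> length w"
    "lz_len w p = 1 \<or> (\<exists>q<p. take (lz_len w p) (drop q w) = take (lz_len w p) (drop p w))"
    by metis+
qed

text \<open>A window lying inside the copied block would be copied along with it and hence occur
  earlier, at \<open>q + i\<close>.\<close>

lemma new_at_not_copied: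
  assumes "new_at w L (p + i)" "q < p" "take l (drop q w) = take l (drop p w)"
  shows "l < i + L"
proof (rule ccontr)
  assume "\<not> l < i + L"
  then have "take L (drop (r + i) w) = take L (drop i (take l (drop r w)))" for r
    by (simp add: drop_take take_take min_absorb1 add.commute)
  then have "take L (drop (q + i) w) = take L (drop (p + i) w)" using assms(3) by simp
  with assms(1,2) show False by (auto simp: new_at_def)
qed

text \<open>The set \<open>E\<close> consists of the last positions of the phrases: an occurrence contained in a
  copied phrase is not the leftmost one.\<close>

lemma phrase_ends_from:
  "\<exists>E. finite E \<and> card E \<le> length (lz_parse_from w p) \<and>
     (\<forall>L\<ge>1. \<forall>x\<ge>p. new_at w L x \<longrightarrow> (\<exists>e\<in>E. x \<le> e \<and> e < x + L))"
proof (induction w p rule: lz_parse_from.induct)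
  case (1 w p)
  show ?case
  proof (cases "p < length w")
    case False
    then show ?thesis by (intro exI[of _ "{}"]) (auto simp: new_at_def)
  next
    case True
    define l where "l = lz_len w p"
    have l: "l \<ge> 1" using lz_len_pos[OF True] l_def by simp
    from 1[OF True] obtain E where E: "finite E" "card E \<le> length (lz_parse_from w (p + l))"
      "\<And>L x. L \<ge> 1 \<Longrightarrow> x \<ge> p + l \<Longrightarrow> new_at w L x \<Longrightarrow> \<exists>e\<in>E. x \<le> e \<and> e < x + L"
      unfolding l_def by blast
    have "\<exists>e\<in>insert (p + l - 1) E. x \<le> e \<and> e < x + L"
      if x: "L \<ge> 1" "x \<ge> p" "new_at w L x" for L x
    proof (cases "x \<ge> p + l")
      case True
      then show ?thesis using E(3) x by blast
    next
      case xl: False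
      from lz_len_cases(2)[OF True] have "p + l \<le> x + L"
      proof
        assume "lz_len w p = 1"
        then show ?thesis using x l_def by simp
      next
        assume "\<exists>q<p. take (lz_len w p) (drop q w) = take (lz_len w p) (drop p w)"
        then obtain q where q: "q < p" "take l (drop q w) = take l (drop p w)"
          by (auto simp: l_def)
        from new_at_not_copied[OF _ this, of L "x - p"] x show ?thesis by simp
      qed
      then show ?thesis using x xl l by (intro bexI[of _ "p + l - 1"]) auto
    qed
    moreover have "card (insert (p + l - 1) E) \<le> length (lz_parse_from w p)"
      using E True by (subst lz_parse_from.simps) (simp add: card_insert_if l_def)
    ultimately show ?thesis using E(1) by (intro exI[of _ "insert (p + l - 1) E"]) auto
  qed
qed

lemma phrase_ends:
  obtains E where "finite E" "card E \<le> z_LZ w"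
    "\<And>L x. L \<ge> 1 \<Longrightarrow> new_at w L x \<Longrightarrow> \<exists>e\<in>E. x \<le> e \<and> e < x + L"
  using phrase_ends_from[of w 0] unfolding z_LZ_def lz77_parse_def by auto

lemma z_LZ_pos: "w \<noteq> [] \<Longrightarrow> z_LZ w \<ge> 1"
  unfolding z_LZ_def lz77_parse_def by (subst lz_parse_from.simps) simp

lemma new_at_exists:
  assumes "p < length w"
  shows "\<exists>q. new_at w L q \<and> take L (drop q w) = take L (drop p w)"
proof -
  define q where "q = (LEAST q. take L (drop q w) = take L (drop p w))"
  have q: "take L (drop q w) = take L (drop p w)" "q \<le> p"
    unfolding q_def by (rule LeastI[of _ p], simp) (rule Least_le, simp)
  moreover have "take L (drop r w) \<noteq> take L (drop p w)" if "r < q" for r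
    using not_less_Least[OF that[unfolded q_def]] .
  ultimately show ?thesis using assms by (intro exI[of _ q]) (auto simp: new_at_def)
qed

text \<open>Each \<open>e\<close> is met only by the intervals of length \<open>L\<close> that start
  at \<open>e - i\<close> with \<open>i < L\<close>.\<close>

lemma card_near:
  assumes "finite E" "\<And>x. x \<in> X \<Longrightarrow> \<exists>e\<in>E. x \<le> e \<and> e < x + (L::nat)"
  shows "finite X" "card X \<le> card E * L"
proof -
  have sub: "X \<subseteq> (\<Union>e\<in>E. {x. x \<le> e \<and> e < x + L})" using assms(2) by blast
  have fin: "finite {x. x \<le> e \<and> e < x + L}" for e by (rule finite_subset[of _ "{..e}"]) auto
  have "{x. x \<le> e \<and> e < x + L} \<subseteq> (\<lambda>i. e - i) ` {..<L}" for e
  proof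
    fix x assume "x \<in> {x. x \<le> e \<and> e < x + L}"
    then have "x = e - (e - x)" "e - x \<in> {..<L}" by auto
    then show "x \<in> (\<lambda>i. e - i) ` {..<L}" by (rule image_eqI)
  qed
  then have card: "card {x. x \<le> e \<and> e < x + L} \<le> L" for e
    using surj_card_le[of "{..<L}" "{x. x \<le> e \<and> e < x + L}" "\<lambda>i. e - i"] by simp
  have "card (\<Union>e\<in>E. {x. x \<le> e \<and> e < x + L}) \<le> (\<Sum>e\<in>E. card {x. x \<le> e \<and> e < x + L})"
    by (rule card_UN_le[OF assms(1)])
  also have "\<dots> \<le> card E * L"
    using sum_bounded_above[of E "\<lambda>e. card {x. x \<le> e \<and> e < x + L}" L, OF card] by simp
  finally have "card (\<Union>e\<in>E. {x. x \<le> e \<and> e < x + L}) \<le> card E * L" .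
  moreover have U: "finite (\<Union>e\<in>E. {x. x \<le> e \<and> e < x + L})" using assms(1) fin by simp
  ultimately show "card X \<le> card E * L" using card_mono[OF U sub] by simp
  show "finite X" by (rule finite_subset[OF sub U])
qed

section \<open>Cyclic windows of the Lyndon factors\<close>

definition cyc_window :: "nat \<Rightarrow> 'a list \<Rightarrow> nat \<Rightarrow> 'a list" where
  "cyc_window L u k = map (\<lambda>j. u ! ((k + j) mod length u)) [0..<L]"

text \<open>Lets positions of the whole word index the cyclic windows of its factors, so that
  counting positions bounds the number of windows.\<close>

lemma nth_concat_map_append:
  assumes "\<And>u. length (f u) = length u" "k < length u"
  shows "concat (map f (ys @ u # zs)) ! (length (concat ys) + k) = f u ! k"
proof -
  have "length (concat (map f ys)) = length (concat ys)"
    by (induction ys) (simp_all add: assms(1))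
  then show ?thesis
    using nth_append_length_plus[of "concat (map f ys)" "f u @ concat (map f zs)" k]
      nth_append_left[of k "f u" "concat (map f zs)"] assms by simp
qed

text \<open>A suffix starting inside some factor \<open>v\<close> begins with a suffix of
  \<open>v\<close>, which is at least \<open>v\<close> and thus at least \<open>u\<close>; extending
  it to the right only increases it.\<close>

lemma lyndon_le_drop_concat:
  assumes "lyndon u" "\<forall>v\<in>set vs. lyndon v \<and> u \<le> v" "q < length (concat vs)"
  shows "u \<le> drop q (concat vs @ S)"
  using assms(2,3)
proof (induction vs arbitrary: q)
  case (Cons v vs)
  show ?case
  proof (cases "q < length v")
    case True
    have "u \<le> v" using Cons.prems by simp
    also have "v \<le> drop q v" using Cons.prems lyndon_le_drop[OF _ True] by simp
    also have "drop q v \<le> drop q v @ concat vs @ S" by (rule le_append_lex)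
    finally show ?thesis using True by simp
  next
    case False
    then show ?thesis using Cons by simp
  qed
qed simp

lemma cyc_window_take:
  assumes "k < length u" "L + k \<le> length u"
  shows "cyc_window L u k = take L (drop k u)"
  using assms by (intro nth_equalityI) (auto simp: cyc_window_def)

lemma cyc_window_take_wrap:
  assumes "k < length u" "L \<le> length u"
  shows "cyc_window L u k = take L (drop k u @ take L u)"
proof (rule nth_equalityI)
  fix i assume "i < length (cyc_window L u k)"
  then have i: "i < L" by (simp add: cyc_window_def)
  show "cyc_window L u k ! i = take L (drop k u @ take L u) ! i"
  proof (cases "k + i < length u")
    case True
    then have "i < length u - k" by simp
    then show ?thesis using True i assms by (simp add: cyc_window_def nth_append)
  next
    case False
    then have "(k + i) mod length u = k + i - length u" using i assms
      by (simp add: mod_if)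
    moreover have "\<not> i < length u - k" using False by simp
    ultimately show ?thesis using i assms by (simp add: cyc_window_def nth_append add.commute)
  qed
qed (use assms in \<open>simp add: cyc_window_def\<close>)

lemma take_append_cong: "take L as = take L bs \<Longrightarrow> take L (xs @ as) = take L (xs @ bs)"
  by (drule arg_cong[of _ _ "take (L - length xs)"]) (simp add: min_absorb1)

text \<open>The part \<open>S\<close> of the word after the last copy of a factor \<open>u\<close> continues \<open>u\<close> cyclically for
  \<open>L\<close> letters, or else the position of \<open>S\<close> is new, because all earlier suffixes are at least \<open>u\<close>.\<close>

lemma cyc_window_cases:
  fixes w :: "'a::linorder list"
  assumes fac: "is_lyndon_factorization w (ys @ u # zs)" and u: "u \<notin> set zs"
    and k: "k < length u" and L: "L \<ge> 1"
  defines "x \<equiv> length (concat ys) + k" and "R \<equiv> length (concat ys) + length u"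
  shows "cyc_window L u k = take L (drop x w) \<or> R < x + L \<and> (R = length w \<or> new_at w L R)"
proof (cases "cyc_window L u k = take L (drop x w)")
  case neq: False
  have w: "w = concat ys @ u @ concat zs" and lyn: "lyndon u" "\<forall>v\<in>set ys. lyndon v \<and> u \<le> v"
    and zs: "\<forall>v\<in>set zs. v \<le> u"
    using fac by (auto simp: is_lyndon_factorization_def sorted_wrt_append)
  have zs': "\<forall>v\<in>set zs. v < u" using zs u by (metis order_le_less)
  have dx: "drop x w = drop k u @ concat zs" using k by (simp add: x_def w)
  have dR: "drop R w = concat zs" by (simp add: R_def w)
  have "length u < k + L"
  proof (rule ccontr)
    assume "\<not> length u < k + L"
    then have "cyc_window L u k = take L (drop x w)" using k cyc_window_take[of k u L]
      by (simp add: dx)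
    with neq show False ..
  qed
  moreover have "new_at w L R" if "R \<noteq> length w"
  proof -
    \<comment> \<open>Within \<open>c\<close> letters the remaining text must deviate from
      \<open>u\<close>. For \<open>c = length u\<close> this is because all later factors are
      strictly below \<open>u\<close>; for \<open>c = L < length u\<close>, agreement would make the
      text continue the window cyclically.\<close>
    define c where "c = min L (length u)"
    have c: "take c (concat zs) \<noteq> take c u"
    proof (cases "length u \<le> L")
      case True
      then show ?thesis using lyndon_not_prefix_concat[OF lyn(1) zs'] by (simp add: c_def)
    next
      case False
      show ?thesis
      proof
        assume "take c (concat zs) = take c u"
        then have "take L (concat zs) = take L u" using False by (simp add: c_def)
        then have "take L (drop x w) = take L (drop k u @ take L u)"
          unfolding dx by (intro take_append_cong) simp
        with cyc_window_take_wrap[OF k, of L] False neq show False by simp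
      qed
    qed
    have "take L (drop q w) \<noteq> take L (drop R w)" if q: "q < R" for q
    proof
      assume eq: "take L (drop q w) = take L (drop R w)"
      have "u \<le> drop q (concat (ys @ [u]) @ concat zs)"
        by (rule lyndon_le_drop_concat) (use lyn q in \<open>auto simp: R_def\<close>)
      then have "take c u \<le> take c (drop q w)" using take_mono_lex w by fastforce
      also have "\<dots> = take c (concat zs)" using arg_cong[OF eq, of "take c"] dR
        by (simp add: c_def min.commute min.left_commute)
      finally have "take c u \<le> take c (concat zs)" .
      moreover have "take c (concat zs) \<le> take c u"
        using take_concat_le_lyndon[OF lyn(1) zs, of c] by (simp add: c_def)
      ultimately show False using c by simp
    qed
    then show ?thesis using that by (simp add: new_at_def R_def w)
  qed
  ultimately show ?thesis by (auto simp: x_def R_def)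
qed simp

text \<open>With \<open>z = z_LZ w\<close>, windows occurring in \<open>w\<close> are counted by
  leftmost occurrences, at most \<open>z * L\<close>. The others are counted by start positions near
  a phrase end or the end of \<open>w\<close>, at most
  \<open>(z + 1) * (2 * L) \<le> 4 * z * L\<close>. Together this gives the factor 5.\<close>

lemma card_cyc_windows:
  fixes w :: "'a::linorder list"
  assumes "is_lyndon_factorization w us" "L \<ge> 1" "w \<noteq> []"
  defines "W \<equiv> {cyc_window L u k |u k. u \<in> set us \<and> k < length u}"
  shows "card W \<le> 5 * z_LZ w * L"
proof -
  obtain E where E: "finite E" "card E \<le> z_LZ w"
    "\<And>L x. L \<ge> 1 \<Longrightarrow> new_at w L x \<Longrightarrow> \<exists>e\<in>E. x \<le> e \<and> e < x + L"
    by (rule phrase_ends[of w]) blast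
  \<comment> \<open>The end of the word is added for the case that no text follows the last copy of
    the factor.\<close>
  define E' where "E' = insert (length w) E"
  define V where "V = concat (map (\<lambda>u. map (cyc_window L u) [0..<length u]) us)"
  define A where "A = {x. new_at w L x}"
  \<comment> \<open>The range doubles because the start \<open>x\<close> lies less than
    \<open>L\<close> before the end \<open>R\<close> of the copy, and \<open>R\<close> less than
    \<open>L\<close> before some \<open>e\<close> in \<open>E'\<close>.\<close>
  define B where "B = {x. \<exists>e\<in>E'. x \<le> e \<and> e < x + 2 * L}"
  have A: "finite A" "card A \<le> card E * L"
    using card_near[OF E(1), of A L] E(3)[OF assms(2)] by (auto simp: A_def)
  have E': "finite E'" "card E' \<le> z_LZ w + 1" using E by (auto simp: E'_def card_insert_if)
  have B: "finite B" "card B \<le> card E' * (2 * L)"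
    using card_near[OF E'(1), of B "2 * L"] by (auto simp: B_def)
  have sub: "W \<subseteq> (\<lambda>p. take L (drop p w)) ` A \<union> (\<lambda>x. V ! x) ` B"
  proof
    fix v assume "v \<in> W"
    then obtain u k where uk: "u \<in> set us" "k < length u" and v: "v = cyc_window L u k"
      by (auto simp: W_def)
    obtain ys zs where us: "us = ys @ u # zs" "u \<notin> set zs" using split_list_last[OF uk(1)] by blast
    define x where "x = length (concat ys) + k"
    define R where "R = length (concat ys) + length u"
    have xw: "x < length w" "x < R"
      using assms(1) uk(2) by (auto simp: is_lyndon_factorization_def us x_def R_def)
    have Vx: "V ! x = v"
      using nth_concat_map_append[of "\<lambda>u. map (cyc_window L u) [0..<length u]" k u ys zs] uk(2)
      by (simp add: V_def us x_def v)
    from cyc_window_cases[OF _ us(2) uk(2) assms(2), of w ys] assms(1) us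
    consider "v = take L (drop x w)" | "R < x + L" "R = length w \<or> new_at w L R"
      by (auto simp: v x_def R_def)
    then show "v \<in> (\<lambda>p. take L (drop p w)) ` A \<union> (\<lambda>x. V ! x) ` B"
    proof cases
      case 1
      then show ?thesis using new_at_exists[OF xw(1), of L]
        by (metis A_def UnI1 image_eqI mem_Collect_eq)
    next
      case 2
      have "\<exists>e\<in>E'. R \<le> e \<and> e < R + L" using 2(2) E(3)[OF assms(2), of R] assms(2)
        by (auto simp: E'_def)
      then obtain e where "e \<in> E'" "R \<le> e" "e < R + L" by blast
      then have "x \<in> B" using 2(1) xw(2) unfolding B_def by (auto intro!: bexI[of _ e])
      then show ?thesis using Vx by blast
    qed
  qed
  have "card W \<le> card ((\<lambda>p. take L (drop p w)) ` A \<union> (\<lambda>x. V ! x) ` B)"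
    using sub A(1) B(1) by (intro card_mono) auto
  also have "\<dots> \<le> card A + card B"
    by (rule card_Un_le[THEN le_trans]) (intro add_mono card_image_le A(1) B(1))
  also have "\<dots> \<le> card E * L + card E' * (2 * L)"
    by (intro add_mono A(2) B(2))
  also have "\<dots> \<le> z_LZ w * L + (z_LZ w + 1) * (2 * L)"
    by (intro add_mono mult_right_mono E(2) E'(2)) auto
  also have "\<dots> \<le> z_LZ w * L + (2 * z_LZ w) * (2 * L)"
    using z_LZ_pos[OF assms(3)] by (intro add_mono mult_mono) auto
  also have "\<dots> = 5 * z_LZ w * L" by simp
  finally show "card W \<le> 5 * z_LZ w * L" .
qed

section \<open>Runs of a sorted shift-closed family\<close>

lemma length_remdups_adj_le:
  "length (remdups_adj s) \<le> 1 + card {i. Suc i < length s \<and> s ! i \<noteq> s ! Suc i}"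
proof (induction s rule: remdups_adj.induct)
  case (3 x y s)
  let ?A = "\<lambda>s. {i. Suc i < length s \<and> s ! i \<noteq> s ! Suc i}"
  have fin: "finite (?A (y # s))" by (rule finite_subset[of _ "{..length s}"]) auto
  have "?A (x # y # s) = (if x = y then {} else {0}) \<union> Suc ` ?A (y # s)"
  proof (rule set_eqI)
    fix n
    show "n \<in> ?A (x # y # s) \<longleftrightarrow> n \<in> (if x = y then {} else {0}) \<union> Suc ` ?A (y # s)"
      by (cases n) auto
  qed
  then have "card (?A (x # y # s)) = (if x = y then 0 else 1) + card (?A (y # s))"
    using fin by (simp add: card_image card_insert_if)
  then show ?case using 3 by (auto split: if_splits)
qed auto

text \<open>Every doubling contributes a factor 2 and no other step decreases \<open>g\<close>. This
  limits how often a single window can be charged.\<close>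

lemma two_power_card_doublings_le:
  fixes g :: "nat \<Rightarrow> nat"
  assumes "1 \<le> g 0" "\<And>k. k < l \<Longrightarrow> g k \<le> g (Suc k)"
  shows "2 ^ card {k. k < l \<and> 2 * g k \<le> g (Suc k)} \<le> g l"
  using assms(2)
proof (induction l)
  case (Suc l)
  let ?K = "\<lambda>l. {k. k < l \<and> 2 * g k \<le> g (Suc k)}"
  have fin: "finite (?K l)" by simp
  have IH: "2 ^ card (?K l) \<le> g l" using Suc by simp
  have "?K (Suc l) = (if 2 * g l \<le> g (Suc l) then insert l (?K l) else ?K l)"
    by (auto simp: less_Suc_eq)
  then show ?case using IH fin Suc.prems[of l] by (auto simp: card_insert_if)
qed (use assms(1) in simp)

text \<open>Words are indexed by the integers so that the cyclic left context is available:
  comparisons read the indices \<open>\<ge> 0\<close>, while index \<open>-1\<close> holds the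
  letter recorded in the transform.\<close>

definition shift :: "int \<Rightarrow> (int \<Rightarrow> 'a) \<Rightarrow> int \<Rightarrow> 'a" where
  "shift k f = (\<lambda>i. f (i + k))"

definition lex_less :: "(int \<Rightarrow> 'a::linorder) \<Rightarrow> (int \<Rightarrow> 'a) \<Rightarrow> bool" where
  "lex_less f g \<longleftrightarrow> (\<exists>k::nat. (\<forall>i<k. f (int i) = g (int i)) \<and> f (int k) < g (int k))"

definition agree :: "nat \<Rightarrow> (int \<Rightarrow> 'a) \<Rightarrow> (int \<Rightarrow> 'a) \<Rightarrow> bool" where
  "agree m f g \<longleftrightarrow> (\<forall>i<m. f (int i) = g (int i))"

definition window :: "nat \<Rightarrow> (int \<Rightarrow> 'a) \<Rightarrow> 'a list" where
  "window L f = map (\<lambda>i. f (int i)) [0..<L]"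

lemma length_window [simp]: "length (window L f) = L"
  by (simp add: window_def)

lemma nth_window [simp]: "i < L \<Longrightarrow> window L f ! i = f (int i)"
  by (simp add: window_def)

lemma window_eq_iff: "window L f = window L g \<longleftrightarrow> agree L f g"
  by (auto simp: window_def agree_def)

lemma not_agree_lex:
  assumes "\<not> agree m f g"
  obtains k where "k < m" "agree k f g" "f (int k) \<noteq> g (int k)"
proof -
  define k where "k = (LEAST k. f (int k) \<noteq> g (int k))"
  obtain j where j: "j < m" "f (int j) \<noteq> g (int j)" using assms by (auto simp: agree_def)
  have "f (int k) \<noteq> g (int k)" "k \<le> j" unfolding k_def using j(2)
    using LeastI[of "\<lambda>k. f (int k) \<noteq> g (int k)" j] Least_le[of "\<lambda>k. f (int k) \<noteq> g (int k)" j]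
    by auto
  moreover have "agree k f g" using not_less_Least by (fastforce simp: agree_def k_def)
  ultimately show ?thesis using that[of k] j(1) by simp
qed

text \<open>At a first mismatch before \<open>m\<close>, \<open>f\<close> would be below
  \<open>g\<close>; since \<open>h\<close> agrees with \<open>f\<close> there, \<open>h\<close>
  would be below \<open>g\<close> as well.\<close>

lemma agree_sandwich:
  assumes "\<not> lex_less g f" "\<not> lex_less h g" "agree m f h"
  shows "agree m f g"
proof (rule ccontr)
  assume "\<not> agree m f g"
  then obtain k where k: "k < m" "agree k f g" "f (int k) \<noteq> g (int k)" by (rule not_agree_lex)
  have "\<not> g (int k) < f (int k)" using assms(1) k(2) unfolding lex_less_def agree_def by metis
  with k(3) have "f (int k) < g (int k)" by simp
  moreover have "\<forall>i\<le>k. f (int i) = h (int i)" using assms(3) k(1) by (auto simp: agree_def)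
  ultimately have "lex_less h g" using k(2) unfolding lex_less_def agree_def
    by (intro exI[of _ k]) auto
  with assms(2) show False ..
qed

section \<open>Charging run boundaries to windows\<close>

locale shift_closed_sorted =
  fixes fs :: "(int \<Rightarrow> 'a::linorder) list"
  assumes sorted: "sorted_wrt (\<lambda>f g. \<not> lex_less g f) fs"
    and shift_in: "f \<in> set fs \<Longrightarrow> shift k f \<in> set fs"
begin

definition boundary :: "nat \<Rightarrow> bool" where
  "boundary i \<longleftrightarrow> Suc i < length fs \<and> (fs ! i) (-1) \<noteq> (fs ! Suc i) (-1)"

text \<open>The boundaries whose neighbours have a longest common prefix of length in
  \<open>[a, b)\<close>.\<close>

definition boundaries_between :: "nat \<Rightarrow> nat \<Rightarrow> nat set" where
  "boundaries_between a b =
     {i. boundary i \<and> agree a (fs ! i) (fs ! Suc i) \<and> \<not> agree b (fs ! i) (fs ! Suc i)}"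

definition occ :: "nat \<Rightarrow> 'a list \<Rightarrow> nat \<Rightarrow> nat" where
  "occ l v k = card {u \<in> set fs. \<forall>i. k \<le> i \<and> i < l \<longrightarrow> u (int i) = v ! i}"

text \<open>The set of possible charges. The counts read only the first \<open>l\<close> letters of
  \<open>v\<close>; the full length \<open>3 * l\<close> guarantees \<open>2 * l\<close> letters
  from index \<open>k + 1\<close> on, enough to recover the boundary being charged.\<close>

definition halving :: "nat \<Rightarrow> ('a list \<times> nat) set" where
  "halving l = {(v, k). v \<in> window (3 * l) ` set fs \<and> k < l \<and> 2 * occ l v k \<le> occ l v (Suc k)}"

lemma finite_boundaries: "finite {i. boundary i}"
  by (rule finite_subset[of _ "{..length fs}"]) (auto simp: boundary_def)

lemma finite_boundaries_between: "finite (boundaries_between a b)"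
  by (rule finite_subset[OF _ finite_boundaries]) (auto simp: boundaries_between_def)

lemma sorted_nth: "i \<le> j \<Longrightarrow> j < length fs \<Longrightarrow> \<not> lex_less (fs ! j) (fs ! i)"
  using sorted_wrt_nth_less[OF sorted, of i j] by (cases "i = j") (auto simp: lex_less_def)

text \<open>For a fixed window \<open>v\<close>, the counts \<open>occ l v k\<close> grow with
  \<open>k\<close> from at least 1, as \<open>v\<close> itself occurs, to at most
  \<open>2 ^ N\<close>; so they double at most \<open>N\<close> times.\<close>

lemma card_halving_le:
  assumes "card (set fs) \<le> 2 ^ N"
  shows "finite (halving l)" "card (halving l) \<le> card (window (3 * l) ` set fs) * N"
proof -
  let ?W = "window (3 * l) ` set fs"
  let ?K = "\<lambda>v. {k. k < l \<and> 2 * occ l v k \<le> occ l v (Suc k)}"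
  have eq: "halving l = Sigma ?W ?K" by (auto simp: halving_def)
  then show "finite (halving l)" by simp
  have "card (?K v) \<le> N" if v: "v \<in> ?W" for v
  proof -
    obtain f where f: "f \<in> set fs" "v = window (3 * l) f" using v by auto
    then have "f \<in> {u \<in> set fs. \<forall>i. 0 \<le> i \<and> i < l \<longrightarrow> u (int i) = v ! i}" by auto
    then have "1 \<le> occ l v 0" unfolding occ_def by (auto simp: Suc_le_eq card_gt_0_iff)
    moreover have "occ l v k \<le> occ l v (Suc k)" for k
      unfolding occ_def by (intro card_mono) auto
    ultimately have "2 ^ card (?K v) \<le> occ l v l"
      by (intro two_power_card_doublings_le) auto
    also have "\<dots> \<le> card (set fs)" unfolding occ_def by (intro card_mono) auto
    also note assms
    finally show ?thesis by simp
  qed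
  then have "(\<Sum>v\<in>?W. card (?K v)) \<le> card ?W * N"
    using sum_bounded_above[of ?W "\<lambda>v. card (?K v)" N] by simp
  then show "card (halving l) \<le> card ?W * N" unfolding eq by simp
qed

text \<open>For boundaries \<open>i < j\<close>, one of the middle entries \<open>Suc i\<close> and
  \<open>j\<close> is sandwiched between the two agreeing entries. It then agrees on
  \<open>b\<close> letters with its partner across the boundary, which is excluded.\<close>

lemma boundaries_between_agree_eq:
  assumes "i \<in> boundaries_between a b" "j \<in> boundaries_between a b"
    and "agree b (fs ! i) (fs ! j) \<or> agree b (fs ! Suc i) (fs ! Suc j)"
  shows "i = j"
proof -
  have *: "\<not> i < j"
    if i: "i \<in> boundaries_between a b" and j: "j \<in> boundaries_between a b"
      and ag: "agree b (fs ! i) (fs ! j) \<or> agree b (fs ! Suc i) (fs ! Suc j)" for i j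
  proof
    assume "i < j"
    moreover have "Suc j < length fs" using j by (simp add: boundaries_between_def boundary_def)
    ultimately have le: "\<not> lex_less (fs ! Suc i) (fs ! i)" "\<not> lex_less (fs ! j) (fs ! Suc i)"
        "\<not> lex_less (fs ! Suc j) (fs ! j)"
      by (simp_all add: sorted_nth)
    have na: "\<not> agree b (fs ! i) (fs ! Suc i)" "\<not> agree b (fs ! j) (fs ! Suc j)"
      using i j by (auto simp: boundaries_between_def)
    from ag show False
    proof
      assume "agree b (fs ! i) (fs ! j)"
      from agree_sandwich[OF le(1,2) this] na(1) show False by blast
    next
      assume ag: "agree b (fs ! Suc i) (fs ! Suc j)"
      from agree_sandwich[OF le(2,3) this] ag na(2) show False by (auto simp: agree_def)
    qed
  qed
  have "agree b (fs ! j) (fs ! i) \<or> agree b (fs ! Suc j) (fs ! Suc i)"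
    using assms(3) by (auto simp: agree_def)
  with *[of i j] *[of j i] assms show ?thesis by (meson linorder_neqE_nat)
qed

lemma window_shift_agree:
  assumes "window (3 * l) (shift (- int (Suc k)) f) = window (3 * l) (shift (- int (Suc k)) g)"
    and "k < l"
  shows "agree (2 * l) f g"
  unfolding agree_def
proof (intro allI impI)
  fix i assume "i < 2 * l"
  then have "i + Suc k < 3 * l" using assms(2) by simp
  with assms(1) have "shift (- int (Suc k)) f (int (i + Suc k)) = shift (- int (Suc k)) g (int (i + Suc k))"
    unfolding window_eq_iff agree_def by blast
  then show "f (int i) = g (int i)" by (simp add: shift_def)
qed

text \<open>The contexts to the left of the two neighbours at a boundary differ in their last letter, so
  one of them occurs at most half as often as the common part; charge that one, at each of
  \<open>l\<close> alignments.\<close>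

lemma boundary_halving:
  assumes i: "i \<in> boundaries_between l (2 * l)" and k: "k < l"
  defines "f \<equiv> shift (- int (Suc k)) (fs ! i)" and "g \<equiv> shift (- int (Suc k)) (fs ! Suc i)"
  shows "(window (3 * l) f, k) \<in> halving l \<or> (window (3 * l) g, k) \<in> halving l"
proof -
  let ?v = "window (3 * l) f" and ?v' = "window (3 * l) g"
  let ?O = "\<lambda>v k. {u \<in> set fs. \<forall>i. k \<le> i \<and> i < l \<longrightarrow> u (int i) = v ! i}"
  have b: "Suc i < length fs" "(fs ! i) (-1) \<noteq> (fs ! Suc i) (-1)" "agree l (fs ! i) (fs ! Suc i)"
    using i by (auto simp: boundaries_between_def boundary_def)
  then have fg: "f \<in> set fs" "g \<in> set fs" by (auto simp: f_def g_def intro!: shift_in)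
  have vk: "?v ! k \<noteq> ?v' ! k" using k b(2) by (simp add: f_def g_def shift_def)
  have vi: "?v ! j = ?v' ! j" if j: "Suc k \<le> j" "j < l" for j
  proof -
    have "shift (- int (Suc k)) h (int j) = h (int (j - Suc k))" for h :: "int \<Rightarrow> 'a"
      unfolding shift_def by (rule arg_cong[where f = h]) (use j in linarith)
    moreover have "j - Suc k < l" using j by simp
    ultimately show ?thesis using j b(3) unfolding f_def g_def using j by (simp add: agree_def del: of_nat_Suc of_nat_diff)
  qed
  then have eq: "?O ?v' (Suc k) = ?O ?v (Suc k)" by auto
  have disj: "?O ?v k \<inter> ?O ?v' k = {}"
  proof (rule equals0I)
    fix u assume u: "u \<in> ?O ?v k \<inter> ?O ?v' k"
    then have "?v ! k = u (int k)" "u (int k) = ?v' ! k" using k by (blast intro: sym)+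
    with vk show False by (blast intro: trans)
  qed
  have "?O ?v k \<subseteq> ?O ?v (Suc k)" "?O ?v' k \<subseteq> ?O ?v' (Suc k)" by auto
  then have "?O ?v k \<union> ?O ?v' k \<subseteq> ?O ?v (Suc k)" unfolding eq by (rule Un_least)
  then have "card (?O ?v k \<union> ?O ?v' k) \<le> occ l ?v (Suc k)"
    unfolding occ_def by (intro card_mono) auto
  moreover have "card (?O ?v k \<union> ?O ?v' k) = occ l ?v k + occ l ?v' k"
    unfolding occ_def by (intro card_Un_disjoint disj) auto
  moreover have "occ l ?v' (Suc k) = occ l ?v (Suc k)" unfolding occ_def using eq by simp
  ultimately have "2 * occ l ?v k \<le> occ l ?v (Suc k) \<or> 2 * occ l ?v' k \<le> occ l ?v' (Suc k)"
    by linarith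
  then show ?thesis using fg k by (auto simp: halving_def)
qed

text \<open>Double counting: each pair of a boundary and an alignment is charged through its left
  neighbour (\<open>F\<close>) or its right one (\<open>G\<close>). Both charging maps are injective
  because \<open>2 * l\<close> common letters determine the boundary; hence the factor 2.\<close>

lemma card_boundaries_between_scale:
  assumes "card (set fs) \<le> 2 ^ N"
  shows "card (boundaries_between l (2 * l)) * l \<le> 2 * (card (window (3 * l) ` set fs) * N)"
proof -
  let ?B = "boundaries_between l (2 * l)"
  define F where "F = (\<lambda>(i, k). (window (3 * l) (shift (- int (Suc k)) (fs ! i)), k))"
  define G where "G = (\<lambda>(i, k). (window (3 * l) (shift (- int (Suc k)) (fs ! Suc i)), k))"
  define X where "X = {p \<in> ?B \<times> {..<l}. F p \<in> halving l}"
  define Y where "Y = {p \<in> ?B \<times> {..<l}. G p \<in> halving l}"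
  note fin = card_halving_le(1)[OF assms, of l]
  have "card X \<le> card (halving l)"
  proof (rule card_inj_on_le[OF _ _ fin])
    show "inj_on F X"
    proof (rule inj_onI)
      fix p q assume pq: "p \<in> X" "q \<in> X" "F p = F q"
      obtain i k where p: "p = (i, k)" by (cases p)
      obtain j where q: "q = (j, k)" using pq(3) p by (cases q) (auto simp: F_def)
      have ij: "i \<in> ?B" "j \<in> ?B" "k < l" using pq(1,2) p q by (auto simp: X_def)
      have "agree (2 * l) (fs ! i) (fs ! j)"
        by (rule window_shift_agree[OF _ ij(3)]) (use pq(3) p q in \<open>simp only: F_def prod.case prod.inject\<close>)
      then have "i = j" using boundaries_between_agree_eq ij by blast
      then show "p = q" using p q by simp
    qed
  qed (auto simp: X_def)
  moreover have "card Y \<le> card (halving l)"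
  proof (rule card_inj_on_le[OF _ _ fin])
    show "inj_on G Y"
    proof (rule inj_onI)
      fix p q assume pq: "p \<in> Y" "q \<in> Y" "G p = G q"
      obtain i k where p: "p = (i, k)" by (cases p)
      obtain j where q: "q = (j, k)" using pq(3) p by (cases q) (auto simp: G_def)
      have ij: "i \<in> ?B" "j \<in> ?B" "k < l" using pq(1,2) p q by (auto simp: Y_def)
      have "agree (2 * l) (fs ! Suc i) (fs ! Suc j)"
        by (rule window_shift_agree[OF _ ij(3)]) (use pq(3) p q in \<open>simp only: G_def prod.case prod.inject\<close>)
      then have "i = j" using boundaries_between_agree_eq ij by blast
      then show "p = q" using p q by simp
    qed
  qed (auto simp: Y_def)
  moreover have "?B \<times> {..<l} = X \<union> Y"
    using boundary_halving by (auto simp: X_def Y_def F_def G_def)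
  then have "card ?B * l \<le> card X + card Y"
    using card_Un_le[of X Y] by (metis card_cartesian_product card_lessThan)
  ultimately show ?thesis using card_halving_le(2)[OF assms, of l] by linarith
qed

lemma card_boundaries_between_0: "card (boundaries_between 0 1) \<le> card (window 1 ` set fs)"
proof (rule card_inj_on_le[where f = "\<lambda>i. window 1 (fs ! i)"])
  show "inj_on (\<lambda>i. window 1 (fs ! i)) (boundaries_between 0 1)"
    by (auto simp: inj_on_def window_eq_iff intro: boundaries_between_agree_eq)
  show "(\<lambda>i. window 1 (fs ! i)) ` boundaries_between 0 1 \<subseteq> window 1 ` set fs"
    by (auto simp: boundaries_between_def boundary_def)
qed simp

text \<open>The 1 is for the first run and \<open>A\<close> for boundaries with empty common prefix.
  Each of the \<open>T\<close> scales \<open>l = 2 ^ t\<close> adds at most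
  \<open>6 * A * N\<close>, since \<open>2 * (A * 3 * l) * N\<close> charges are shared by
  \<open>l\<close> alignments per boundary.\<close>

theorem runs_le:
  assumes N: "card (set fs) \<le> 2 ^ N"
    and A: "\<And>L. L \<ge> 1 \<Longrightarrow> card (window L ` set fs) \<le> A * L"
    and T: "\<And>i. boundary i \<Longrightarrow> \<not> agree (2 ^ T) (fs ! i) (fs ! Suc i)"
  shows "runs (map (\<lambda>f. f (-1)) fs) \<le> 1 + A + 6 * A * N * T"
proof -
  have scale: "card (boundaries_between (2 ^ t) (2 ^ Suc t)) \<le> 6 * A * N" for t
  proof -
    let ?l = "2 ^ t :: nat"
    have "card (boundaries_between ?l (2 * ?l)) * ?l \<le> 2 * (card (window (3 * ?l) ` set fs) * N)"
      by (rule card_boundaries_between_scale[OF N])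
    also have "\<dots> \<le> 2 * (A * (3 * ?l) * N)" by (intro mult_left_mono mult_right_mono A) auto
    also have "\<dots> = 6 * A * N * ?l" by simp
    finally show ?thesis by simp
  qed
  have *: "card {i. boundary i \<and> \<not> agree (2 ^ t) (fs ! i) (fs ! Suc i)} \<le> A + 6 * A * N * t" for t
  proof (induction t)
    case 0
    have "{i. boundary i \<and> \<not> agree (2 ^ 0) (fs ! i) (fs ! Suc i)} = boundaries_between 0 1"
      by (auto simp: boundaries_between_def agree_def)
    then show ?case using card_boundaries_between_0 A[of 1] by simp
  next
    case (Suc t)
    let ?R = "\<lambda>t. {i. boundary i \<and> \<not> agree (2 ^ t) (fs ! i) (fs ! Suc i)}"
    have "?R (Suc t) \<subseteq> ?R t \<union> boundaries_between (2 ^ t) (2 ^ Suc t)"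
      by (auto simp: boundaries_between_def)
    moreover have "finite (?R t)" by (rule finite_subset[OF _ finite_boundaries]) auto
    ultimately have "card (?R (Suc t)) \<le> card (?R t \<union> boundaries_between (2 ^ t) (2 ^ Suc t))"
      using finite_boundaries_between by (intro card_mono) auto
    also have "\<dots> \<le> card (?R t) + card (boundaries_between (2 ^ t) (2 ^ Suc t))"
      by (rule card_Un_le)
    also have "\<dots> \<le> (A + 6 * A * N * t) + 6 * A * N" by (intro add_mono Suc.IH scale)
    finally show ?case by simp
  qed
  have "{i. Suc i < length fs \<and> map (\<lambda>f. f (-1)) fs ! i \<noteq> map (\<lambda>f. f (-1)) fs ! Suc i} =
      {i. boundary i \<and> \<not> agree (2 ^ T) (fs ! i) (fs ! Suc i)}"
    using T by (auto simp: boundary_def)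
  then show ?thesis
    using length_remdups_adj_le[of "map (\<lambda>f. f (-1)) fs"] *[of T] by (simp add: runs_def)
qed

end

section \<open>The bijective BWT\<close>

definition biinf :: "'a list \<Rightarrow> int \<Rightarrow> 'a" where
  "biinf x i = x ! nat (i mod int (length x))"

lemma biinf_periodic: "biinf x (i + int (length x) * j) = biinf x i"
  by (simp add: biinf_def)

lemma biinf_nth: "i < length x \<Longrightarrow> biinf x (int i) = x ! i"
  by (simp add: biinf_def)

lemma biinf_in_set: "x \<noteq> [] \<Longrightarrow> biinf x i \<in> set x"
  by (simp add: biinf_def nat_less_iff)

lemma biinf_last:
  assumes "x \<noteq> []"
  shows "biinf x (-1) = last x"
proof -
  have "biinf x (-1) = biinf x (-1 + int (length x) * 1)" by (rule biinf_periodic[symmetric])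
  also have "\<dots> = biinf x (int (length x - 1))" using assms by (simp add: of_nat_diff Suc_le_eq)
  also have "\<dots> = x ! (length x - 1)" using assms by (intro biinf_nth) simp
  finally show ?thesis using assms by (simp add: last_conv_nth)
qed

lemma biinf_rotate:
  assumes "x \<noteq> []"
  shows "biinf (rotate k x) = shift (int k) (biinf x)"
proof
  fix i
  define r where "r = nat (i mod int (length x))"
  have r: "r < length x" "int r = i mod int (length x)"
    using assms by (auto simp: r_def nat_less_iff)
  have "biinf (rotate k x) i = x ! ((k + r) mod length x)"
    using r by (simp add: biinf_def nth_rotate flip: r_def)
  also have "(k + r) mod length x = nat ((int k + int r) mod int (length x))"
    by (metis nat_int of_nat_add zmod_int)
  also have "(int k + int r) mod int (length x) = (i + int k) mod int (length x)"
    unfolding r(2) by (simp add: mod_add_right_eq add.commute)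
  finally show "biinf (rotate k x) i = shift (int k) (biinf x) i"
    by (simp add: shift_def biinf_def)
qed

lemma window_biinf_rotate:
  assumes "u \<noteq> []"
  shows "window L (biinf (rotate k u)) = cyc_window L u k"
proof (rule nth_equalityI)
  fix i assume "i < length (window L (biinf (rotate k u)))"
  then have "window L (biinf (rotate k u)) ! i = u ! nat (int (k + i) mod int (length u))"
    using assms by (simp add: biinf_rotate shift_def biinf_def add.commute)
  also have "nat (int (k + i) mod int (length u)) = (k + i) mod length u"
    by (metis nat_int zmod_int)
  finally show "window L (biinf (rotate k u)) ! i = cyc_window L u k ! i"
    using \<open>i < length (window L (biinf (rotate k u)))\<close> by (simp add: cyc_window_def)
qed (simp add: cyc_window_def)

lemma omega_less_iff_lex_less:
  assumes "x \<noteq> []" "y \<noteq> []"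
  shows "omega_less x y \<longleftrightarrow> lex_less (biinf x) (biinf y)"
proof -
  have "cycle z !! i = biinf z (int i)" if "z \<noteq> []" for z :: "'a list" and i
  proof -
    have "cycle z !! i = hd (rotate (i mod length z) z)"
      using that by (simp add: sdrop_cycle flip: sdrop_simps(1))
    also have "\<dots> = z ! (i mod length z)" using that by (simp add: hd_rotate_conv_nth)
    also have "\<dots> = biinf z (int i)" by (simp add: biinf_def nat_mod_as_int)
    finally show ?thesis .
  qed
  then show ?thesis using assms by (simp add: omega_less_def lex_less_def)
qed

text \<open>The product of the lengths is a common period, so agreement over that range extends to
  all integers.\<close>

lemma biinf_eq_if_agree:
  assumes "agree (length x * length y) (biinf x) (biinf y)" "x \<noteq> []" "y \<noteq> []"
  shows "biinf x = biinf y"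
proof
  fix i
  define m where "m = int (length x) * int (length y)"
  have m: "m > 0" using assms(2,3) by (simp add: m_def)
  define r where "r = nat (i mod m)"
  have r: "int r = i mod m" using m by (simp add: r_def)
  have "i mod m < m" using m by simp
  then have "r < length x * length y" using r by (simp add: m_def flip: of_nat_mult)
  then have "biinf x (int r) = biinf y (int r)" using assms(1) by (simp add: agree_def)
  then show "biinf x i = biinf y i" unfolding r by (simp add: biinf_def m_def mod_mod_cancel)
qed

text \<open>A period \<open>d < length u\<close> would make the proper suffix
  \<open>drop d u\<close> also a prefix of \<open>u\<close>, hence at most \<open>u\<close>.\<close>

lemma lyndon_period_ge:
  assumes "lyndon u" "d > 0" "\<And>i. biinf u (i + int d) = biinf u i"
  shows "length u \<le> d"
proof (rule ccontr)
  assume d: "\<not> length u \<le> d"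
  have "drop d u = take (length u - d) u"
  proof (rule nth_equalityI)
    fix i assume i: "i < length (drop d u)"
    have "drop d u ! i = biinf u (int i + int d)"
      using i by (simp add: biinf_nth add.commute flip: of_nat_add)
    also have "\<dots> = u ! i" using i assms(3) by (simp add: biinf_nth)
    finally show "drop d u ! i = take (length u - d) u ! i" using i by simp
  qed simp
  then have "drop d u \<le> u" by (simp add: take_le_lex)
  with lyndon_less_drop[OF assms(1,2)] d show False by simp
qed

text \<open>The common word has both lengths as periods, hence also their gcd by Bezout; negative
  coefficients are harmless on two-sided words. By the period bound for Lyndon words both lengths
  equal the gcd.\<close>

lemma biinf_rotate_inj:
  assumes "lyndon u" "lyndon v" "biinf (rotate k u) = biinf (rotate l v)"
  shows "rotate k u = rotate l v"
proof -
  note ne = lyndon_nonempty[OF assms(1)] lyndon_nonempty[OF assms(2)]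
  define g where "g = gcd (length u) (length v)"
  define f where "f = biinf (rotate k u)"
  have pu: "f (i + int (length u) * j) = f i" for i j
    using biinf_periodic[of "rotate k u"] by (simp add: f_def)
  have pv: "f (i + int (length v) * j) = f i" for i j
    using biinf_periodic[of "rotate l v"] by (simp add: f_def assms(3))
  obtain a b where "a * int (length u) + b * int (length v) = int g"
    using bezout_int[of "int (length u)" "int (length v)"] by (auto simp: g_def)
  then have fg: "f (i + int g) = f i" for i
    using pv[of "i + int (length u) * a" b] pu[of i a] by (simp add: algebra_simps)
  have "biinf z (i + int g) = biinf z i" if "f = shift m (biinf z)" for z i m
    using fg[of "i - m"] by (simp add: that shift_def algebra_simps)
  moreover have "f = shift (int k) (biinf u)" "f = shift (int l) (biinf v)"
    using assms(3) ne by (simp_all add: f_def biinf_rotate)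
  moreover have "g > 0" using ne by (simp add: g_def)
  ultimately have "length u \<le> g" "length v \<le> g" using lyndon_period_ge assms(1,2) by blast+
  moreover have "g \<le> length u" "g \<le> length v" using ne by (auto simp: g_def intro: gcd_le1_nat gcd_le2_nat)
  ultimately have len: "length u = length v" by simp
  show ?thesis
  proof (rule nth_equalityI)
    fix i assume i: "i < length (rotate k u)"
    then show "rotate k u ! i = rotate l v ! i"
      using biinf_nth[of i "rotate k u"] biinf_nth[of i "rotate l v"] assms(3) len by simp
  qed (simp add: len)
qed

section \<open>Uniqueness of the sorted list of rotations\<close>

lemma window_less_iff:
  "window M f < window M g \<longleftrightarrow> (\<exists>k<M. agree k f g \<and> f (int k) < g (int k))"
proof -
  have "take k (window M h) = window k h" if "k < M" for k and h :: "int \<Rightarrow> 'a"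
    using that by (intro nth_equalityI) auto
  then show ?thesis unfolding list_less_def lexord_take_index_conv
    by (auto simp: window_eq_iff)
qed

lemma lex_less_iff_window:
  assumes "agree M f g \<Longrightarrow> f = g"
  shows "lex_less f g \<longleftrightarrow> window M f < window M g"
proof (cases "agree M f g")
  case True
  with assms have "f = g" by simp
  then show ?thesis by (simp add: lex_less_def)
next
  case False
  then obtain j where j: "j < M" "f (int j) \<noteq> g (int j)" by (auto simp: agree_def)
  have lt: "k < M" if "agree k f g" for k
  proof (rule ccontr)
    assume "\<not> k < M"
    then have "j < k" using j(1) by simp
    then show False using that j(2) by (simp add: agree_def)
  qed
  have "lex_less f g \<longleftrightarrow> (\<exists>k. agree k f g \<and> f (int k) < g (int k))"
    by (simp only: lex_less_def agree_def)
  then show ?thesis unfolding window_less_iff using lt by blast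
qed

lemma set_bbwt_rotations:
  "set_mset (bbwt_rotations w) = {rotate k u |k u. u \<in> set (lyndon_factors w) \<and> k < length u}"
  by (auto simp: bbwt_rotations_def rotations_def) blast

lemma bbwt_rotation_nonempty: "x \<in># bbwt_rotations w \<Longrightarrow> x \<noteq> []"
  by (auto simp: set_bbwt_rotations)

lemma lyndon_factors_props:
  assumes "u \<in> set (lyndon_factors w)"
  shows "lyndon u" "length u \<le> length w"
proof -
  have f: "concat (lyndon_factors w) = w" "\<forall>u\<in>set (lyndon_factors w). lyndon u"
    using is_lyndon_factorization_lyndon_factors[of w] by (auto simp: is_lyndon_factorization_def)
  then show "lyndon u" using assms by simp
  obtain ys zs where "lyndon_factors w = ys @ u # zs" using split_list[OF assms] by blast
  then have "length (concat (lyndon_factors w)) \<ge> length u" by simp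
  then show "length u \<le> length w" using f(1) by simp
qed

lemma size_bbwt_rotations: "size (bbwt_rotations w) = length w"
proof -
  have "length (concat (map rotations us)) = length (concat us)" for us :: "'a list list"
    by (induction us) (auto simp: rotations_def)
  then show ?thesis
    using is_lyndon_factorization_lyndon_factors[of w]
    by (simp add: bbwt_rotations_def is_lyndon_factorization_def)
qed

context
  fixes w :: "'a::linorder list" and x y
  assumes xy: "x \<in># bbwt_rotations w" "y \<in># bbwt_rotations w"
begin

lemma bbwt_rotation_agree:
  assumes "agree (length w * length w) (biinf x) (biinf y)"
  shows "x = y"
proof -
  obtain k u l v where x: "x = rotate k u" "u \<in> set (lyndon_factors w)"
    and y: "y = rotate l v" "v \<in> set (lyndon_factors w)"
    using xy by (auto simp: set_bbwt_rotations)
  note u = lyndon_factors_props[OF x(2)] and v = lyndon_factors_props[OF y(2)]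
  have "length x * length y \<le> length w * length w" using x(1) y(1) u(2) v(2) by (simp add: mult_mono)
  then have "agree (length x * length y) (biinf x) (biinf y)" using assms by (auto simp: agree_def)
  moreover have "x \<noteq> []" "y \<noteq> []" using x(1) y(1) u(1) v(1) lyndon_nonempty by auto
  ultimately have "biinf x = biinf y" by (rule biinf_eq_if_agree)
  then show ?thesis using biinf_rotate_inj u(1) v(1) x(1) y(1) by blast
qed

lemma bbwt_rotation_less_iff:
  "omega_less x y \<longleftrightarrow>
     window (length w * length w) (biinf x) < window (length w * length w) (biinf y)"
proof -
  have "x \<noteq> []" "y \<noteq> []"
    using xy by (simp_all add: bbwt_rotation_nonempty)
  moreover have "agree (length w * length w) (biinf x) (biinf y) \<Longrightarrow> biinf x = biinf y"
    using bbwt_rotation_agree by simp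
  ultimately show ?thesis by (simp add: omega_less_iff_lex_less lex_less_iff_window)
qed

end

text \<open>Comparing prefixes of length \<open>n\<^sup>2\<close> embeds the \<open>\<omega>\<close>-order into the lexicographic one.\<close>

lemma bbwt_matrix_unique:
  "\<exists>!xs. mset xs = bbwt_rotations w \<and> sorted_wrt (\<lambda>x y. \<not> omega_less y x) xs"
proof -
  define key where "key x = window (length w * length w) (biinf x)" for x :: "'a list"
  have inj: "inj_on key (set_mset (bbwt_rotations w))"
    by (rule inj_onI) (simp add: key_def window_eq_iff bbwt_rotation_agree)
  have sorted_iff: "sorted_wrt (\<lambda>x y. \<not> omega_less y x) xs \<longleftrightarrow> sorted (map key xs)"
    if "mset xs = bbwt_rotations w" for xs
  proof -
    have "set xs = set_mset (bbwt_rotations w)" using that by (metis set_mset_mset)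
    then show ?thesis unfolding sorted_wrt_map
      by (intro iffI; elim sorted_wrt_mono_rel[rotated]) (auto simp: bbwt_rotation_less_iff key_def not_less)
  qed
  show ?thesis
  proof (rule ex_ex1I)
    let ?xs = "sort_key key (concat (map rotations (lyndon_factors w)))"
    have "mset ?xs = bbwt_rotations w" by (simp add: bbwt_rotations_def)
    with sorted_iff show "\<exists>xs. mset xs = bbwt_rotations w \<and> sorted_wrt (\<lambda>x y. \<not> omega_less y x) xs"
      by (metis sorted_sort_key)
  next
    fix xs ys
    assume "mset xs = bbwt_rotations w \<and> sorted_wrt (\<lambda>x y. \<not> omega_less y x) xs"
      "mset ys = bbwt_rotations w \<and> sorted_wrt (\<lambda>x y. \<not> omega_less y x) ys"
    then have xs: "mset xs = bbwt_rotations w" "sorted (map key xs)"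
      and ys: "mset ys = bbwt_rotations w" "sorted (map key ys)"
      using sorted_iff by auto
    have "mset (map key xs) = mset (map key ys)" using xs ys by simp
    with xs(2) ys(2) have "map key xs = map key ys" by (metis properties_for_sort)
    moreover have "set xs = set_mset (bbwt_rotations w)" "set ys = set_mset (bbwt_rotations w)"
      using xs(1) ys(1) by (metis set_mset_mset)+
    ultimately show "xs = ys" using inj by (auto intro: map_inj_on)
  qed
qed

lemma bbwt_matrix_eqI:
  "mset xs = bbwt_rotations w \<Longrightarrow> sorted_wrt (\<lambda>x y. \<not> omega_less y x) xs \<Longrightarrow> bbwt_matrix w = xs"
  unfolding bbwt_matrix_def using bbwt_matrix_unique by (blast intro: the1_equality)

lemma bbwt_matrix_props:
  "mset (bbwt_matrix w) = bbwt_rotations w"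
  "sorted_wrt (\<lambda>x y. \<not> omega_less y x) (bbwt_matrix w)"
  using theI'[OF bbwt_matrix_unique[of w]] unfolding bbwt_matrix_def by blast+

text \<open>Apply the run bound with \<open>A = 5 * z_LZ w\<close> and \<open>T = 2 * N\<close>:
  neighbours agreeing on \<open>2 ^ (2 * N)\<close> letters, at least the square of the word length,
  are equal and form no boundary.\<close>

lemma r_B_le_nat:
  fixes w :: "'a::linorder list"
  assumes w: "w \<noteq> []" and N: "length w \<le> 2 ^ N"
  shows "r_B w \<le> 1 + 5 * z_LZ w + 6 * (5 * z_LZ w) * N * (2 * N)"
proof -
  define fs where "fs = map biinf (bbwt_matrix w)"
  have set_m: "set (bbwt_matrix w) = {rotate k u |k u. u \<in> set (lyndon_factors w) \<and> k < length u}"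
    using arg_cong[OF bbwt_matrix_props(1), of set_mset w] by (simp add: set_bbwt_rotations)
  have in_m: "x \<in># bbwt_rotations w" if "x \<in> set (bbwt_matrix w)" for x
    using that unfolding set_mset_mset[symmetric] bbwt_matrix_props(1) .
  then have ne: "x \<noteq> []" if "x \<in> set (bbwt_matrix w)" for x
    using that bbwt_rotation_nonempty by blast
  have set_fs: "set fs = {biinf (rotate k u) |k u. u \<in> set (lyndon_factors w) \<and> k < length u}"
    by (auto simp: fs_def set_m)
  interpret shift_closed_sorted fs
  proof
    show "sorted_wrt (\<lambda>f g. \<not> lex_less g f) fs"
      unfolding fs_def sorted_wrt_map
      by (rule sorted_wrt_mono_rel[OF _ bbwt_matrix_props(2)])
        (simp add: omega_less_iff_lex_less ne)
  next
    fix f j assume "f \<in> set fs"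
    then obtain k u where u: "u \<in> set (lyndon_factors w)" and f: "f = biinf (rotate k u)"
      by (auto simp: set_fs)
    have "u \<noteq> []" using lyndon_factors_props(1)[OF u] lyndon_nonempty by blast
    \<comment> \<open>An arbitrary integer shift of a rotation is again a rotation, by the amount
      reduced modulo the length of the factor.\<close>
    define k' where "k' = nat ((int k + j) mod int (length u))"
    have k': "k' < length u" "int k' = (int k + j) mod int (length u)"
      using \<open>u \<noteq> []\<close> by (auto simp: k'_def nat_less_iff)
    have "shift j f = shift (int k') (biinf u)"
    proof
      fix i
      have "(i + j + int k) mod int (length u) = (i + int k') mod int (length u)"
        unfolding k'(2) by (simp add: mod_add_right_eq algebra_simps)
      then show "shift j f i = shift (int k') (biinf u) i"
        using \<open>u \<noteq> []\<close> by (simp add: f biinf_rotate shift_def biinf_def)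
    qed
    then have "shift j f = biinf (rotate k' u)" using \<open>u \<noteq> []\<close> by (simp add: biinf_rotate)
    then show "shift j f \<in> set fs" using u k'(1) by (auto simp: set_fs)
  qed
  have "card (set fs) \<le> length w"
    using card_length[of fs] bbwt_matrix_props(1)[of w] size_bbwt_rotations[of w]
    by (metis fs_def length_map size_mset)
  then have card: "card (set fs) \<le> 2 ^ N" using N by simp
  have win: "card (window L ` set fs) \<le> 5 * z_LZ w * L" if "L \<ge> 1" for L
  proof -
    have "window L ` set fs = {cyc_window L u k |u k. u \<in> set (lyndon_factors w) \<and> k < length u}"
      using lyndon_factors_props(1) lyndon_nonempty
      by (force simp: set_fs image_iff window_biinf_rotate)
    then show ?thesis
      using card_cyc_windows[OF is_lyndon_factorization_lyndon_factors that w] by simp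
  qed
  have far: "\<not> agree (2 ^ (2 * N)) (fs ! i) (fs ! Suc i)" if i: "boundary i" for i
  proof
    assume ag: "agree (2 ^ (2 * N)) (fs ! i) (fs ! Suc i)"
    have "length w * length w \<le> 2 ^ N * 2 ^ N" using N by (intro mult_mono) auto
    also have "\<dots> = 2 ^ (2 * N)" by (simp add: mult_2 power_add)
    finally have ag': "agree (length w * length w) (fs ! i) (fs ! Suc i)"
      using ag by (auto simp: agree_def)
    have b: "Suc i < length fs" "(fs ! i) (-1) \<noteq> (fs ! Suc i) (-1)"
      using i by (auto simp: boundary_def)
    then have len: "i < length (bbwt_matrix w)" "Suc i < length (bbwt_matrix w)"
      by (auto simp: fs_def)
    then have "bbwt_matrix w ! i = bbwt_matrix w ! Suc i"
      using ag' by (intro bbwt_rotation_agree[of _ w]) (auto simp: fs_def intro!: in_m)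
    then show False using b len by (simp add: fs_def)
  qed
  have "bbwt w = map (\<lambda>f. f (-1)) fs"
    using ne by (auto simp: bbwt_def fs_def biinf_last)
  then show ?thesis using runs_le[OF card win far] by (simp add: r_B_def)
qed

text \<open>Rounding the logarithm up at most doubles it, as it is at least 1, so
  \<open>60 * N\<^sup>2\<close> costs at most 240 squared logarithms;
  \<open>1 + 5 * z \<le> 6 * z\<close> with \<open>z = z_LZ w\<close> supplies the other 6.\<close>

lemma r_B_le:
  fixes w :: "'a::linorder list"
  assumes "length w \<ge> 2"
  shows "real (r_B w) \<le> 246 * real (z_LZ w) * (log 2 (real (length w)))\<^sup>2"
proof -
  let ?l = "log 2 (real (length w))" and ?z = "real (z_LZ w)"
  define N where "N = nat \<lceil>?l\<rceil>"
  have l: "?l \<ge> 1" using assms by (subst le_log_iff) auto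
  have w: "w \<noteq> []" using assms by auto
  have z: "?z \<ge> 1" using z_LZ_pos[OF w] by simp
  have "?l \<le> real N" using l by (simp add: N_def)
  then have "real (length w) \<le> 2 powr real N" using assms by (subst (asm) log_le_iff) auto
  then have "real (length w) \<le> real (2 ^ N)" by (simp add: powr_realpow)
  then have "length w \<le> 2 ^ N" by (simp only: of_nat_le_iff)
  from r_B_le_nat[OF w this] have "r_B w \<le> 1 + 5 * z_LZ w + 60 * z_LZ w * N\<^sup>2"
    by (simp add: power2_eq_square algebra_simps)
  then have "real (r_B w) \<le> real (1 + 5 * z_LZ w + 60 * z_LZ w * N\<^sup>2)" by (simp only: of_nat_le_iff)
  also have "\<dots> = 1 + 5 * ?z + 60 * ?z * (real N)\<^sup>2" by simp
  finally have r: "real (r_B w) \<le> 1 + 5 * ?z + 60 * ?z * (real N)\<^sup>2" .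
  have "real N \<le> 2 * ?l" using l by (simp add: N_def) linarith
  then have "(real N)\<^sup>2 \<le> (2 * ?l)\<^sup>2" by (intro power_mono) auto
  then have "60 * ?z * (real N)\<^sup>2 \<le> 60 * ?z * (4 * ?l\<^sup>2)"
    by (intro mult_left_mono) (auto simp: power_mult_distrib)
  moreover have "?z * 1 \<le> ?z * ?l\<^sup>2" using l by (intro mult_left_mono) auto
  ultimately show ?thesis using r z by linarith
qed

section \<open>Change of alphabet\<close>

lemma runs_map: "inj_on h (set s) \<Longrightarrow> runs (map h s) = runs s"
  unfolding runs_def
  by (induction s rule: remdups_adj.induct) (auto simp: inj_on_def)

lemma lz_len_map:
  assumes "inj_on h (set w)" "p < length w"
  shows "lz_len (map h w) p = lz_len w p"
proof -
  have tk: "take l (drop q (map h w)) = take l (drop p (map h w)) \<longleftrightarrow>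
      take l (drop q w) = take l (drop p w)" for l q
  proof -
    have "set (take l (drop r w)) \<subseteq> set w" for r by (auto dest: in_set_takeD in_set_dropD)
    then have "inj_on h (set (take l (drop q w)) \<union> set (take l (drop p w)))"
      by (intro inj_on_subset[OF assms(1)]) auto
    then show ?thesis unfolding drop_map take_map by (rule inj_on_map_eq_map)
  qed
  have "h (w ! p) \<in> h ` set (take p w) \<longleftrightarrow> w ! p \<in> set (take p w)"
    using assms by (intro inj_on_image_mem_iff[OF assms(1)]) (auto dest: in_set_takeD)
  then show ?thesis
    unfolding lz_len_def tk length_map using assms(2) by (simp add: take_map)
qed

lemma z_LZ_map:
  assumes "inj_on h (set w)"
  shows "z_LZ (map h w) = z_LZ w"
proof -
  have "length (lz_parse_from (map h w) p) = length (lz_parse_from w p)" for p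
    using assms
  proof (induction w p rule: lz_parse_from.induct)
    case (1 w p)
    then show ?case
      by (subst (1 2) lz_parse_from.simps) (simp add: lz_len_map)
  qed
  then show ?thesis by (simp add: z_LZ_def lz77_parse_def)
qed

section \<open>Order-preserving renaming of letters\<close>

context
  fixes h :: "'a::linorder \<Rightarrow> 'b::linorder" and A :: "'a set"
  assumes h: "strict_mono_on A h"
begin

lemma h_less: "a \<in> A \<Longrightarrow> b \<in> A \<Longrightarrow> h a < h b \<longleftrightarrow> a < b"
  using strict_mono_on_less[OF h] by blast

lemma h_eq: "a \<in> A \<Longrightarrow> b \<in> A \<Longrightarrow> h a = h b \<longleftrightarrow> a = b"
  using strict_mono_on_imp_inj_on[OF h] by (auto simp: inj_on_def)

lemma map_less_iff: "set xs \<subseteq> A \<Longrightarrow> set ys \<subseteq> A \<Longrightarrow> map h xs < map h ys \<longleftrightarrow> xs < ys"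
proof (induction xs arbitrary: ys)
  case Nil
  then show ?case by (cases ys) auto
next
  case (Cons x xs)
  then show ?case by (cases ys) (auto simp: h_less h_eq)
qed

lemma lyndon_map:
  assumes "lyndon u" "set u \<subseteq> A"
  shows "lyndon (map h u)"
  unfolding lyndon_def
proof (intro conjI allI impI)
  show "map h u \<noteq> []" using assms(1) lyndon_nonempty by auto
  fix a b assume ab: "map h u = a @ b \<and> a \<noteq> [] \<and> b \<noteq> []"
  then obtain c d where u: "u = c @ d" "a = map h c" "b = map h d"
    by (auto simp: map_eq_append_conv)
  then have "u < d" using lyndon_less_suffix[of c d] assms(1) ab by auto
  then show "map h u < b" using map_less_iff[of u d] assms(2) u by auto
qed

text \<open>Renaming preserves Lyndon words and the order of the factors, so uniqueness of the
  factorization identifies the renamed factors.\<close>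

lemma lyndon_factors_map:
  assumes "set w \<subseteq> A"
  shows "lyndon_factors (map h w) = map (map h) (lyndon_factors w)"
proof (rule lyndon_factorization_unique[OF is_lyndon_factorization_lyndon_factors])
  have f: "concat (lyndon_factors w) = w" "\<forall>u\<in>set (lyndon_factors w). lyndon u"
    "sorted_wrt (\<ge>) (lyndon_factors w)"
    using is_lyndon_factorization_lyndon_factors[of w] by (auto simp: is_lyndon_factorization_def)
  have sub: "set u \<subseteq> A" if "u \<in> set (lyndon_factors w)" for u
    using that set_lyndon_factors[of w] assms by blast
  have "sorted_wrt (\<lambda>x y. map h y \<le> map h x) (lyndon_factors w)"
    by (rule sorted_wrt_mono_rel[OF _ f(3)]) (auto simp: map_less_iff sub simp flip: not_less)
  then show "is_lyndon_factorization (map h w) (map (map h) (lyndon_factors w))"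
    using f sub by (auto simp: is_lyndon_factorization_def sorted_wrt_map lyndon_map simp flip: map_concat)
qed

lemma bbwt_rotations_map:
  assumes "set w \<subseteq> A"
  shows "bbwt_rotations (map h w) = image_mset (map h) (bbwt_rotations w)"
proof -
  have "rotations (map h u) = map (map h) (rotations u)" for u
    by (simp add: rotations_def rotate_map)
  then have "map rotations (map (map h) us) = map (map (map h)) (map rotations us)" for us
    by simp
  then show ?thesis
    by (simp only: bbwt_rotations_def lyndon_factors_map[OF assms] mset_map flip: map_concat)
qed

lemma omega_less_map:
  assumes "x \<noteq> []" "y \<noteq> []" "set x \<subseteq> A" "set y \<subseteq> A"
  shows "omega_less (map h x) (map h y) \<longleftrightarrow> omega_less x y"
proof -
  have "biinf (map h z) i = h (biinf z i)" if "z \<noteq> []" for z i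
    using that by (simp add: biinf_def nat_less_iff)
  moreover have "biinf x i \<in> A" "biinf y i \<in> A" for i using assms biinf_in_set by blast+
  ultimately show ?thesis
    using assms by (simp add: omega_less_iff_lex_less lex_less_def h_less h_eq)
qed

text \<open>The renamed matrix is still sorted and has the right multiset of rows; uniqueness of the
  sorted list does the rest.\<close>

lemma bbwt_map:
  assumes "set w \<subseteq> A"
  shows "bbwt (map h w) = map h (bbwt w)"
proof -
  have set_m: "set (bbwt_matrix w) = set_mset (bbwt_rotations w)"
    using arg_cong[OF bbwt_matrix_props(1), of set_mset w] by simp
  have ne: "x \<noteq> []" if "x \<in> set (bbwt_matrix w)" for x
    using that bbwt_rotation_nonempty set_m by blast
  have sub: "set x \<subseteq> A" if x: "x \<in> set (bbwt_matrix w)" for x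
  proof -
    obtain u where "u \<in> set (lyndon_factors w)" "set x = set u"
      using x by (auto simp: set_m set_bbwt_rotations)
    then show ?thesis using assms set_lyndon_factors[of w] by blast
  qed
  have "sorted_wrt (\<lambda>x y. \<not> omega_less (map h y) (map h x)) (bbwt_matrix w)"
    by (rule sorted_wrt_mono_rel[OF _ bbwt_matrix_props(2)]) (simp add: omega_less_map ne sub)
  then have "bbwt_matrix (map h w) = map (map h) (bbwt_matrix w)"
    by (intro bbwt_matrix_eqI) (simp_all add: sorted_wrt_map bbwt_rotations_map[OF assms] bbwt_matrix_props(1))
  then show ?thesis using ne by (auto simp: bbwt_def last_map)
qed

end

lemma set_bbwt: "set (bbwt w) \<subseteq> set w"
proof
  fix a assume "a \<in> set (bbwt w)"
  then obtain x where x: "x \<in># bbwt_rotations w" "a = last x"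
    using arg_cong[OF bbwt_matrix_props(1), of set_mset w] by (auto simp: bbwt_def)
  then obtain u where "u \<in> set (lyndon_factors w)" "set x = set u"
    by (auto simp: set_bbwt_rotations)
  moreover have "a \<in> set x" using x bbwt_rotation_nonempty[OF x(1)] by simp
  ultimately show "a \<in> set w" using set_lyndon_factors[of w] by blast
qed

lemma r_B_map:
  assumes "strict_mono_on (set w) h"
  shows "r_B (map h w) = r_B w"
  using bbwt_map[OF assms order_refl] runs_map[of h "bbwt w"]
    inj_on_subset[OF strict_mono_on_imp_inj_on[OF assms] set_bbwt]
  by (simp add: r_B_def)

text \<open>Each letter is sent to its rank in \<open>A\<close>. As only finitely many letters occur
  in a word, this carries every word over to the naturals.\<close>

lemma ex_strict_mono_on_nat:
  assumes "finite A"
  shows "\<exists>h :: 'a::linorder \<Rightarrow> nat. strict_mono_on A h"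
proof
  show "strict_mono_on A (\<lambda>a. card {b \<in> A. b < a})"
  proof (rule strict_mono_onI)
    fix r s assume "r \<in> A" "s \<in> A" "r < s"
    then show "card {b \<in> A. b < r} < card {b \<in> A. b < s}"
      using assms by (intro psubset_card_mono) auto
  qed
qed

text \<open>Independence of the constant from the alphabet is expressed in two halves: some constant
  works over the naturals, and each constant that works there transfers to every ordered alphabet by
  ranking the letters.\<close>

theorem theorem1:
  "(\<exists>C::real. C > 0 \<and>
      (\<forall>w :: nat list. length w \<ge> 2 \<longrightarrow>
         real (r_B w) \<le> C * real (z_LZ w) * (log 2 (real (length w)))\<^sup>2)) \<and>
   (\<forall>C::real. C > 0 \<longrightarrow>
      (\<forall>w :: nat list. length w \<ge> 2 \<longrightarrow>
         real (r_B w) \<le> C * real (z_LZ w) * (log 2 (real (length w)))\<^sup>2) \<longrightarrow>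
      (\<forall>w :: 'a::linorder list. length w \<ge> 2 \<longrightarrow>
         real (r_B w) \<le> C * real (z_LZ w) * (log 2 (real (length w)))\<^sup>2))"
proof (intro conjI allI impI)
  show "\<exists>C::real. C > 0 \<and>
      (\<forall>w :: nat list. length w \<ge> 2 \<longrightarrow>
         real (r_B w) \<le> C * real (z_LZ w) * (log 2 (real (length w)))\<^sup>2)"
    using r_B_le by (intro exI[of _ 246]) auto
next
  fix C :: real and w :: "'a list"
  assume bound: "\<forall>w :: nat list. length w \<ge> 2 \<longrightarrow>
      real (r_B w) \<le> C * real (z_LZ w) * (log 2 (real (length w)))\<^sup>2"
    and len: "length w \<ge> 2"
  obtain h :: "'a \<Rightarrow> nat" where h: "strict_mono_on (set w) h"
    using ex_strict_mono_on_nat[of "set w"] by auto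
  have "real (r_B (map h w)) \<le> C * real (z_LZ (map h w)) * (log 2 (real (length (map h w))))\<^sup>2"
    using bound[rule_format, of "map h w"] len by simp
  then show "real (r_B w) \<le> C * real (z_LZ w) * (log 2 (real (length w)))\<^sup>2"
    by (simp add: r_B_map[OF h] z_LZ_map[OF strict_mono_on_imp_inj_on[OF h]])
qed

end
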